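(* Let $r\ge 1$ and $k\ge 2$ be integers, let $\mathbf a=(a_1,\dots,a_r)$ be a sequence of positive integers, and let $D=\operatorname{lcm}(a_1,\dots,a_r)$. Let $p_{k,\mathbf a}$ be the restricted $k$-multipartition function and let $d_{k,\mathbf a,m}$ ($0\le m\le rk-1$) be its quasi-polynomial coefficients of period $D$. Put $$\mathbf C=\Big\{(\ell_1,\dots,\ell_r)\in\mathbb Z^r : 0\le \ell_s\le k\Big(\frac{D}{a_s}-1\Big)\text{ for }1\le s\le r\Big\}.$$ Then for every integer $n\ge 0$ and every $0\le m\le rk-1$, $$d_{k,\mathbf a,m}(n)=\frac{1}{(rk-1)!}\sum_{\substack{(\ell_1,\dots,\ell_r)\in\mathbf C\\ a_1\ell_1+\cdots+a_r\ell_r\equiv n\ (\mathrm{mod}\ D)}}\left[\prod_{s=1}^r\left(\sum_{\substack{i_s,j_s\ge 0\\ i_s\frac{D}{a_s}+j_s=\ell_s}}(-1)^{i_s}\binom{k}{i_s}\binom{j_s+k-1}{j_s}\right)\right]\cdot\left[\sum_{t=m}^{rk-1}\genfrac{[}{]}{0pt}{}{rk}{t+1}(-1)^{t-m}\binom{t}{m}D^{-t}(a_1\ell_1+\cdots+a_r\ell_r)^{t-m}\right].$$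
   Context: For integers $n\ge 0$, $p_{k,\mathbf a}(n)$ is the number of $k$-tuples $(x^1,\dots,x^k)$ of vectors $x^j=(x^j_1,\dots,x^j_r)\in\mathbb N^r$ (with $0\in\mathbb N$) such that $\sum_{j=1}^k\sum_{i=1}^r a_i x^j_i=n$. Equivalently, $\sum_{n\ge 0}p_{k,\mathbf a}(n)z^n=\prod_{i=1}^r(1-z^{a_i})^{-k}$ for $|z|<1$. The function $p_{k,\mathbf a}$ is a quasi-polynomial of period $D$: there are (unique) functions $d_{k,\mathbf a,m}:\mathbb N\to\mathbb Q$, $0\le m\le rk-1$, with $d_{k,\mathbf a,m}(n+D)=d_{k,\mathbf a,m}(n)$ for all $n\ge 0$ and $p_{k,\mathbf a}(n)=\sum_{m=0}^{rk-1}d_{k,\mathbf a,m}(n)n^m$ for all $n\ge 0$. These are the coefficients in the statement. $\genfrac{[}{]}{0pt}{}{R}{j}$ denotes the unsigned Stirling numbers of the first kind, so that $(x+1)(x+2)\cdots(x+R-1)=\sum_{t=0}^{R-1}\genfrac{[}{]}{0pt}{}{R}{t+1}x^t$. The convention $0^0=1$ is used, and $\binom{k}{i}=0$ for $i>k$. *)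

theory Defs
  imports Complex_Main "HOL-Library.FuncSet" "HOL-Number_Theory.Cong" "HOL-Combinatorics.Stirling"
begin

text \<open>A sequence \<open>a\<^sub>1, \<dots>, a\<^sub>r\<close> is a function \<open>a\<close> of which only the values on \<open>{1..r}\<close> matter;
  tuples are extensional functions, so that \<open>card\<close> counts each tuple once.\<close>

definition multipartition_count :: "nat \<Rightarrow> nat \<Rightarrow> (nat \<Rightarrow> nat) \<Rightarrow> nat \<Rightarrow> nat" where
  "multipartition_count k r a n =
     card {x \<in> {1..k} \<rightarrow>\<^sub>E ({1..r} \<rightarrow>\<^sub>E (UNIV :: nat set)).
             (\<Sum>j = 1..k. \<Sum>i = 1..r. a i * x j i) = n}"

text \<open>The last conjunct only fixes the values at the irrelevant indices \<open>m \<ge> N\<close>, so that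
  the family of coefficients is unique as a function on all of \<open>nat\<close>.\<close>

definition quasi_poly_coeffs ::
    "(nat \<Rightarrow> nat) \<Rightarrow> nat \<Rightarrow> nat \<Rightarrow> (nat \<Rightarrow> nat \<Rightarrow> rat) \<Rightarrow> bool" where
  "quasi_poly_coeffs p D N d \<longleftrightarrow>
     (\<forall>m<N. \<forall>n. d m (n + D) = d m n) \<and>
     (\<forall>n. of_nat (p n) = (\<Sum>m<N. d m n * of_nat n ^ m)) \<and>
     (\<forall>m\<ge>N. \<forall>n. d m n = 0)"

definition multipartition_coeff ::
    "nat \<Rightarrow> nat \<Rightarrow> (nat \<Rightarrow> nat) \<Rightarrow> nat \<Rightarrow> nat \<Rightarrow> rat" where
  "multipartition_coeff k r a =
     (THE d. quasi_poly_coeffs (multipartition_count k r a) (Lcm (a ` {1..r})) (r * k) d)"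

definition box_C :: "nat \<Rightarrow> nat \<Rightarrow> (nat \<Rightarrow> nat) \<Rightarrow> nat \<Rightarrow> (nat \<Rightarrow> int) set" where
  "box_C k r a D = (\<Pi>\<^sub>E s\<in>{1..r}. {0 .. int k * (int (D div a s) - 1)})"

end

theory Submission imports Defs "HOL-Computational_Algebra.Polynomial_FPS" begin

text \<open>
  Write \<open>R = r * k\<close> and \<open>q\<^sub>s = D / a\<^sub>s\<close>. All factors of the generating function
  \<open>\<Prod>\<^sub>s (1 - X^a\<^sub>s)^(-k)\<close> of \<open>p\<^bsub>k,a\<^esub>\<close> can be brought to the common denominator \<open>1 - X^D\<close>:
  \<open>1 / (1 - X^a\<^sub>s)^k = Q\<^sub>s(X^a\<^sub>s) / (1 - X^D)^k\<close> with \<open>Q\<^sub>s(X) = ((1 - X^q\<^sub>s) / (1 - X))^k\<close>.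
  Here \<open>Q\<^sub>s = (1 + X + \<dots> + X^(q\<^sub>s - 1))^k\<close> is a polynomial of degree \<open>k (q\<^sub>s - 1)\<close>, which is
  the origin of the box \<open>C\<close>, and its coefficients, read off from the quotient form, are the
  inner alternating sums (\<open>factor_coeff\<close>).

  Hence \<open>p\<^bsub>k,a\<^esub>(n)\<close> is the sum over \<open>l\<close> in the box, with \<open>w = \<Sum>\<^sub>s a\<^sub>s l\<^sub>s \<le> n\<close> and \<open>w \<equiv> n\<close> modulo \<open>D\<close>,
  of \<open>\<Prod>\<^sub>s [X^l\<^sub>s] Q\<^sub>s\<close> times the coefficient \<open>binom(y + R - 1, R - 1)\<close> of \<open>X^(D y)\<close> in
  \<open>(1 - X^D)^(-R)\<close>, where \<open>y = (n - w) / D\<close>.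
  The condition \<open>w \<le> n\<close>, which would destroy the quasi-polynomial shape, can be dropped: the
  binomial coefficient is the polynomial \<open>(y + 1) \<cdots> (y + R - 1) / (R - 1)!\<close> in \<open>y\<close>, which vanishes
  at the integers \<open>-R < y < 0\<close>, and \<open>w < R D\<close> on the whole box (\<open>choose_eq_pochhammer\<close>,
  \<open>multipartition_count_eq_sum_box\<close>).

  What remains depends on \<open>n\<close> only through its residue modulo \<open>D\<close> and through a polynomial in
  \<open>n\<close>. Expanding that polynomial with Stirling numbers and the binomial theorem
  (\<open>pochhammer_shifted_expansion\<close>) exhibits quasi-polynomial coefficients, and
  these are unique because a polynomial with infinitely many zeros is zero
  (\<open>quasi_poly_coeffs_unique\<close>).
\<close>

unbundle fps_syntax

section \<open>Generating functions of weighted tuples\<close>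

text \<open>
  Multiplying power series adds exponents, so a product of weight enumerators enumerates tuples
  by total weight. The general index types, sets, weights and coefficients allow three uses: for
  the vectors in \<open>\<nat>\<^sup>r\<close>, for \<open>k\<close>-tuples of such vectors, and for the integer points of the box.
  Finiteness is proved in the same induction, since a sum over an infinite set is \<open>0\<close>.
\<close>

lemma fps_prod_weighted_PiE:
  fixes c :: "'i \<Rightarrow> 'b \<Rightarrow> 'c::comm_ring_1" and w :: "'i \<Rightarrow> 'b \<Rightarrow> nat"
  assumes "finite I" and "\<And>i n. i \<in> I \<Longrightarrow> finite {y \<in> A i. w i y = n}"
  shows "finite {x \<in> Pi\<^sub>E I A. (\<Sum>i\<in>I. w i (x i)) = n} \<and>
    (\<Prod>i\<in>I. Abs_fps (\<lambda>n. \<Sum>y | y \<in> A i \<and> w i y = n. c i y)) $ n =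
      (\<Sum>x | x \<in> Pi\<^sub>E I A \<and> (\<Sum>i\<in>I. w i (x i)) = n. \<Prod>i\<in>I. c i (x i))"
  using assms
proof (induction I arbitrary: n rule: finite_induct)
  case empty
  show ?case by (cases "n = 0") (auto simp: fps_one_nth)
next
  case (insert i I)
  let ?X = "\<lambda>n. {x \<in> Pi\<^sub>E I A. (\<Sum>i\<in>I. w i (x i)) = n}"
  let ?Y = "\<lambda>n. {y \<in> A i. w i y = n}"
  let ?T = "SIGMA j:{0..n}. ?Y j \<times> ?X (n - j)"
  let ?S = "{x \<in> Pi\<^sub>E (insert i I) A. (\<Sum>i\<in>insert i I. w i (x i)) = n}"
  \<comment> \<open>A tuple over \<open>insert i I\<close> is a value \<open>y\<close> at \<open>i\<close> of weight \<open>j\<close> and a tuple over \<open>I\<close> of weight \<open>n - j\<close>;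
     resetting \<open>i\<close> to \<open>undefined\<close> keeps the latter extensional.\<close>
  let ?f = "\<lambda>(j, y, x). x(i := y)"
  let ?g = "\<lambda>x. (w i (x i), x i, x(i := undefined))"
  have upd: "(\<Sum>j\<in>I. w j ((x(i := y)) j)) = (\<Sum>j\<in>I. w j (x j))" for x y
    using insert.hyps by (intro sum.cong) auto
  have updp: "(\<Prod>j\<in>I. c j ((x(i := y)) j)) = (\<Prod>j\<in>I. c j (x j))" for x y
    using insert.hyps by (intro prod.cong) auto
  have finT: "finite ?T"
    using insert.IH insert.prems by (intro finite_SigmaI finite_cartesian_product) auto
  have fT: "?f t \<in> ?S" if "t \<in> ?T" for t
    using that insert.hyps upd by (fastforce simp: PiE_def extensional_def Pi_def split: if_splits)
  have gS: "?g x \<in> ?T" if "x \<in> ?S" for x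
    using that insert.hyps upd[of x undefined]
    by (auto simp: PiE_def extensional_def Pi_def)
  have fg: "?f (?g x) = x" for x by auto
  have gf: "?g (?f t) = t" if "t \<in> ?T" for t
    using that insert.hyps by (auto simp: PiE_def extensional_def fun_eq_iff)
  have "?S \<subseteq> ?f ` ?T"
  proof
    fix x assume "x \<in> ?S"
    from imageI[OF gS[OF this], of ?f] show "x \<in> ?f ` ?T" unfolding fg .
  qed
  then have finS: "finite ?S" using finT by (rule finite_surj[rotated])
  have "(\<Prod>i\<in>insert i I. Abs_fps (\<lambda>n. \<Sum>y | y \<in> A i \<and> w i y = n. c i y)) $ n =
      (\<Sum>j=0..n. (\<Sum>y\<in>?Y j. c i y) * (\<Sum>x\<in>?X (n - j). \<Prod>i\<in>I. c i (x i)))"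
    using insert by (simp add: fps_mult_nth)
  also have "\<dots> = (\<Sum>j=0..n. \<Sum>(y, x)\<in>?Y j \<times> ?X (n - j). c i y * (\<Prod>i\<in>I. c i (x i)))"
    by (simp add: sum_product sum.cartesian_product)
  also have "\<dots> = (\<Sum>(j, y, x)\<in>?T. c i y * (\<Prod>i\<in>I. c i (x i)))"
    using insert.IH insert.prems by (subst sum.Sigma) auto
  also have "\<dots> = (\<Sum>x\<in>?S. \<Prod>i\<in>insert i I. c i (x i))"
  proof (rule sum.reindex_bij_witness[where i = ?g and j = ?f])
    fix t assume "t \<in> ?T"
    then show "?g (?f t) = t" by (rule gf)
  next
    fix t assume "t \<in> ?T"
    then show "?f t \<in> ?S" by (rule fT)
  next
    fix t assume "t \<in> ?S"
    then show "?g t \<in> ?T" by (rule gS)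
  next
    fix t assume "t \<in> ?T"
    then show "(\<Prod>i\<in>insert i I. c i (?f t i)) = (case t of (j, y, x) \<Rightarrow> c i y * (\<Prod>i\<in>I. c i (x i)))"
      using insert.hyps updp by (cases t) (auto simp del: fun_upd_apply simp add: fun_upd_same)
  qed (rule fg)
  finally show ?case using finS by blast
qed

lemma fps_compose_X_power_nth:
  fixes F :: "'a::idom fps"
  assumes "a > 0"
  shows "(F oo fps_X ^ a) $ n = (\<Sum>y | a * y = n. F $ y)"
proof -
  have "(F oo fps_X ^ a) $ n = (\<Sum>i=0..n. if a * i = n then F $ i else 0)"
    unfolding fps_compose_nth
    by (intro sum.cong) (auto simp: fps_X_power_nth simp flip: power_mult)
  also have "\<dots> = (\<Sum>y | y \<in> {0..n} \<and> a * y = n. F $ y)"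
    by (rule sum.inter_filter[symmetric]) simp
  also have "{y. y \<in> {0..n} \<and> a * y = n} = {y. a * y = n}"
    using assms by auto
  finally show ?thesis .
qed

lemma finite_mult_eq: "a > 0 \<Longrightarrow> finite {y::nat. a * y = n}"
  by (rule finite_subset[of _ "{0..n}"]) auto

lemma fps_inverse_one_minus_X_power:
  fixes a :: nat
  assumes "a > 0"
  shows "inverse (1 - fps_X ^ a :: 'a::field fps) = Abs_fps (\<lambda>n. \<Sum>y | y \<in> UNIV \<and> a * y = n. 1)"
proof -
  have "inverse (1 - fps_X ^ a :: 'a fps) = inverse (1 - fps_X) oo fps_X ^ a"
    using assms by (simp add: fps_inverse_compose fps_compose_sub_distrib)
  also have "\<dots> = Abs_fps (\<lambda>n. \<Sum>y | y \<in> UNIV \<and> a * y = n. 1)"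
  proof (intro fps_ext)
    fix n
    have "inverse (1 - fps_X :: 'a fps) = Abs_fps (\<lambda>n. 1)"
      using fps_inverse_gp' fps_inverse_idempotent by (metis fps_nth_Abs_fps zero_neq_one)
    then show "(inverse (1 - fps_X) oo fps_X ^ a) $ n = Abs_fps (\<lambda>n. \<Sum>y | y \<in> UNIV \<and> a * y = n. 1 :: 'a) $ n"
      using fps_compose_X_power_nth[OF assms, of "Abs_fps (\<lambda>n. 1 :: 'a)" n] by simp
  qed
  finally show ?thesis .
qed

text \<open>The enumeration of tuples is applied to the entries of one vector and then to the \<open>k\<close> vectors.\<close>

lemma multipartition_count_fps:
  assumes "\<And>i. i \<in> {1..r} \<Longrightarrow> a i > 0"
  shows "Abs_fps (\<lambda>n. of_nat (multipartition_count k r a n)) =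
    ((\<Prod>i=1..r. inverse (1 - fps_X ^ a i)) ^ k :: 'a::field_char_0 fps)"
proof -
  let ?V = "{1..r} \<rightarrow>\<^sub>E (UNIV :: nat set)"
  have fin: "finite {y \<in> UNIV. a i * y = n}" if "i \<in> {1..r}" for i n
    using finite_mult_eq[OF assms[OF that]] by simp
  have inner: "finite {x \<in> ?V. (\<Sum>i=1..r. a i * x i) = n} \<and>
    (\<Prod>i=1..r. Abs_fps (\<lambda>n. \<Sum>y | y \<in> UNIV \<and> a i * y = n. 1)) $ n =
      (\<Sum>x | x \<in> ?V \<and> (\<Sum>i=1..r. a i * x i) = n. \<Prod>i=1..r. 1 :: 'a)" for n
    using fps_prod_weighted_PiE[of "{1..r}" "\<lambda>_. UNIV" "\<lambda>i y. a i * y" n "\<lambda>_ _. 1::'a"] fin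
    by simp
  have vec: "(\<Prod>i=1..r. inverse (1 - fps_X ^ a i :: 'a fps)) =
      Abs_fps (\<lambda>n. \<Sum>x | x \<in> ?V \<and> (\<Sum>i=1..r. a i * x i) = n. 1)"
  proof (intro fps_ext)
    fix n
    have "(\<Prod>i=1..r. inverse (1 - fps_X ^ a i :: 'a fps)) =
      (\<Prod>i=1..r. Abs_fps (\<lambda>n. \<Sum>y | y \<in> UNIV \<and> a i * y = n. 1))"
      by (intro prod.cong fps_inverse_one_minus_X_power assms) auto
    then show "(\<Prod>i=1..r. inverse (1 - fps_X ^ a i :: 'a fps)) $ n =
      Abs_fps (\<lambda>n. \<Sum>x | x \<in> ?V \<and> (\<Sum>i=1..r. a i * x i) = n. 1) $ n"
      using conjunct2[OF inner[of n]] by (simp only: fps_nth_Abs_fps prod.neutral_const)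
  qed
  show ?thesis
  proof (intro fps_ext)
    fix n
    have "((\<Prod>i=1..r. inverse (1 - fps_X ^ a i :: 'a fps)) ^ k) $ n =
       (\<Prod>j=1..k. Abs_fps (\<lambda>n. \<Sum>x | x \<in> ?V \<and> (\<Sum>i=1..r. a i * x i) = n. 1::'a)) $ n"
      by (simp only: vec prod_constant card_atLeastAtMost diff_Suc_1 Suc_eq_plus1[symmetric])
    also have "\<dots> = (\<Sum>x | x \<in> {1..k} \<rightarrow>\<^sub>E ?V \<and> (\<Sum>j=1..k. \<Sum>i=1..r. a i * x j i) = n. \<Prod>j=1..k. 1)"
      using fps_prod_weighted_PiE[of "{1..k}" "\<lambda>_. ?V" "\<lambda>_ x. \<Sum>i=1..r. a i * x i" n "\<lambda>_ _. 1::'a"]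
        inner by simp
    finally show "Abs_fps (\<lambda>n. of_nat (multipartition_count k r a n)) $ n =
        ((\<Prod>i=1..r. inverse (1 - fps_X ^ a i :: 'a fps)) ^ k) $ n"
      by (simp add: multipartition_count_def)
  qed
qed

section \<open>The numerator polynomials\<close>

text \<open>
  The numerator is expanded by the binomial theorem, and the negative power of \<open>1 - X\<close> by the
  negative binomial series.
\<close>

lemma one_minus_X_power_quotient_nth:
  fixes q k l :: nat
  assumes "q > 0" "k > 0"
  shows "((1 - fps_X ^ q) ^ k * inverse ((1 - fps_X) ^ k) :: 'a::field_char_0 fps) $ l =
    (\<Sum>(i, j) \<in> {(i, j). i * q + j = l}. (- 1) ^ i * of_nat (k choose i) * of_nat ((j + k - 1) choose j))"
proof -
  let ?h = "\<lambda>j. of_nat ((j + k - 1) choose j) :: 'a"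
  have inv: "inverse ((1 - fps_X) ^ k :: 'a fps) = Abs_fps ?h"
    using one_minus_const_fps_X_neg_power'[of k "1::'a"] assms
    by (simp add: add.commute)
  have nth_mult: "(fps_X ^ d * F) $ l = (if d \<le> l then F $ (l - d) else 0)" for d and F :: "'a fps"
    by (simp add: fps_X_power_mult_nth)
  have "(1 - fps_X ^ q :: 'a fps) ^ k = (\<Sum>i\<le>k. of_nat (k choose i) * (- (fps_X ^ q)) ^ i * 1 ^ (k - i))"
    using binomial_ring[of "- (fps_X ^ q :: 'a fps)" 1 k] by simp
  also have "\<dots> = (\<Sum>i\<le>k. fps_const ((-1) ^ i * of_nat (k choose i)) * fps_X ^ (i * q))"
  proof (rule sum.cong[OF refl])
    fix i
    have "(- (fps_X ^ q :: 'a fps)) ^ i = (-1) ^ i * fps_X ^ (i * q)"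
      by (subst power_minus) (simp add: mult.commute flip: power_mult)
    moreover have "fps_const ((-1) ^ i * of_nat (k choose i) :: 'a) = (-1) ^ i * of_nat (k choose i)"
      by (simp add: fps_of_nat flip: fps_const_mult fps_const_power fps_const_neg)
    ultimately show "of_nat (k choose i) * (- (fps_X ^ q :: 'a fps)) ^ i * 1 ^ (k - i) =
       fps_const ((-1) ^ i * of_nat (k choose i)) * fps_X ^ (i * q)" by simp
  qed
  finally have "((1 - fps_X ^ q) ^ k * Abs_fps ?h) $ l =
     (\<Sum>i\<le>k. (fps_const ((-1) ^ i * of_nat (k choose i)) * (fps_X ^ (i * q) * Abs_fps ?h)) $ l)"
    by (simp add: sum_distrib_right fps_sum_nth mult.assoc)
  also have "\<dots> = (\<Sum>i\<le>k. if i * q \<le> l then (-1) ^ i * of_nat (k choose i) * ?h (l - i * q) else 0)"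
    by (intro sum.cong refl) (simp only: fps_mult_left_const_nth nth_mult fps_nth_Abs_fps, simp)
  also have "\<dots> = (\<Sum>i | i \<in> {..k} \<and> i * q \<le> l. (-1) ^ i * of_nat (k choose i) * ?h (l - i * q))"
    by (rule sum.inter_filter[symmetric]) simp
  \<comment> \<open>The terms with \<open>i > k\<close> have binomial coefficient \<open>0\<close>.\<close>
  also have "\<dots> = (\<Sum>i | i * q \<le> l. (-1) ^ i * of_nat (k choose i) * ?h (l - i * q))"
  proof (rule sum.mono_neutral_left)
    show "finite {i. i * q \<le> l}"
    proof (rule finite_subset[of _ "{..l}"])
      have "i \<le> i * q" for i using assms by simp
      then show "{i. i * q \<le> l} \<subseteq> {..l}" using order_trans by blast
    qed simp
  qed auto
  also have "\<dots> = (\<Sum>(i, j) \<in> {(i, j). i * q + j = l}. (- 1) ^ i * of_nat (k choose i) * ?h j)"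
    by (rule sum.reindex_bij_witness[where i = fst and j = "\<lambda>i. (i, l - i * q)"]) auto
  finally show ?thesis unfolding inv .
qed

text \<open>The quotient is the polynomial \<open>(1 + X + \<dots> + X^(q - 1))^k\<close>.\<close>

lemma one_minus_X_power_quotient_nth_eq_0:
  assumes "l > k * (q - 1)"
  shows "((1 - fps_X ^ q) ^ k * inverse ((1 - fps_X) ^ k) :: 'a::field fps) $ l = 0"
proof -
  let ?p = "(\<Sum>i<q. monom 1 i :: 'a poly)"
  have "(1 - fps_X ^ q :: 'a fps) = (1 - fps_X) * (\<Sum>i<q. fps_X ^ i)"
    by (simp add: one_diff_power_eq)
  then have "((1 - fps_X ^ q) ^ k * inverse ((1 - fps_X) ^ k) :: 'a fps) = (\<Sum>i<q. fps_X ^ i) ^ k"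
    using inverse_mult_eq_1'[of "(1 - fps_X :: 'a fps) ^ k"]
    by (simp add: power_mult_distrib fps_nth_power_0 ac_simps)
  also have "\<dots> = fps_of_poly (?p ^ k)"
    by (simp add: fps_of_poly_power fps_of_poly_sum fps_of_poly_monom)
  finally have "((1 - fps_X ^ q) ^ k * inverse ((1 - fps_X) ^ k) :: 'a fps) $ l = coeff (?p ^ k) l"
    by simp
  moreover have "degree ?p \<le> q - 1"
    by (rule degree_sum_le) (auto intro!: order_trans[OF degree_monom_le])
  then have "degree (?p ^ k) \<le> (q - 1) * k"
    using degree_power_le[of ?p k] by (meson le_trans mult_le_mono1)
  ultimately show ?thesis using assms by (simp add: coeff_eq_0 mult.commute)
qed

text \<open>
  The coefficients of \<open>((1 - X^q) / (1 - X))^k\<close>, with an integer index because the box consists of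
  integer vectors.
\<close>

definition factor_coeff :: "nat \<Rightarrow> nat \<Rightarrow> int \<Rightarrow> 'a::comm_ring_1" where
  "factor_coeff k q l = (\<Sum>(i, j) \<in> {(i, j). int i * int q + int j = l}.
     (- 1) ^ i * of_nat (k choose i) * of_nat ((j + k - 1) choose j))"

lemma factor_coeff_int:
  assumes "q > 0" "k > 0"
  shows "factor_coeff k q (int l) =
    (((1 - fps_X ^ q) ^ k * inverse ((1 - fps_X) ^ k)) $ l :: 'a::field_char_0)"
proof -
  have "int i * int q + int j = int l \<longleftrightarrow> i * q + j = l" for i j
    by (simp flip: of_nat_add of_nat_mult)
  then show ?thesis
    unfolding factor_coeff_def one_minus_X_power_quotient_nth[OF assms] by simp
qed

text \<open>
  Substituting \<open>X^a\<close> for \<open>X\<close> in the polynomial gives the series of weights \<open>a * l\<close>, where \<open>l\<close>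
  ranges over one side of the box: beyond it the coefficients vanish.
\<close>

lemma factor_coeff_fps:
  assumes "a > 0" "q > 0" "k > 0"
  shows "Abs_fps (\<lambda>n. \<Sum>l | l \<in> {0..int k * (int q - 1)} \<and> a * nat l = n. factor_coeff k q l) =
    ((1 - fps_X ^ (a * q)) ^ k * inverse (1 - fps_X ^ a) ^ k :: 'a::field_char_0 fps)"
proof (intro fps_ext)
  fix n
  let ?Q = "(1 - fps_X ^ q) ^ k * inverse ((1 - fps_X) ^ k) :: 'a fps"
  have le_iff: "int y \<le> int k * (int q - 1) \<longleftrightarrow> y \<le> k * (q - 1)" for y
    using assms by (metis One_nat_def Suc_leI of_nat_1 of_nat_diff of_nat_le_iff of_nat_mult)
  have le_iff': "l \<le> int k * (int q - 1) \<longleftrightarrow> nat l \<le> k * (q - 1)" if "l \<ge> 0" for l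
    using le_iff[of "nat l"] that by simp
  have "?Q oo fps_X ^ a = (1 - fps_X ^ (a * q)) ^ k * inverse (1 - fps_X ^ a) ^ k"
    using assms
    by (simp add: fps_compose_mult_distrib fps_compose_power[symmetric] fps_compose_sub_distrib
        fps_inverse_power fps_inverse_compose fps_X_power_compose flip: power_mult)
  then have "((1 - fps_X ^ (a * q)) ^ k * inverse (1 - fps_X ^ a) ^ k) $ n = (\<Sum>y | a * y = n. ?Q $ y)"
    using fps_compose_X_power_nth[OF assms(1), of ?Q n] by simp
  also have "\<dots> = (\<Sum>y | a * y = n. factor_coeff k q (int y))"
    using assms by (simp add: factor_coeff_int)
  also have "\<dots> = (\<Sum>y | y \<le> k * (q - 1) \<and> a * y = n. factor_coeff k q (int y))"
  proof (rule sum.mono_neutral_right)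
    show "\<forall>y\<in>{y. a * y = n} - {y. y \<le> k * (q - 1) \<and> a * y = n}. factor_coeff k q (int y) = (0 :: 'a)"
      using assms by (auto simp: factor_coeff_int not_le intro!: one_minus_X_power_quotient_nth_eq_0)
  qed (use assms in \<open>auto intro: finite_mult_eq\<close>)
  also have "\<dots> = (\<Sum>l | l \<in> {0..int k * (int q - 1)} \<and> a * nat l = n. factor_coeff k q l)"
    by (rule sum.reindex_bij_witness[where i = nat and j = int]) (auto simp: le_iff le_iff' simp del: One_nat_def)
  finally show "Abs_fps (\<lambda>n. \<Sum>l | l \<in> {0..int k * (int q - 1)} \<and> a * nat l = n. factor_coeff k q l) $ n =
    ((1 - fps_X ^ (a * q)) ^ k * inverse (1 - fps_X ^ a) ^ k :: 'a fps) $ n" by simp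
qed

section \<open>The count as a sum over the box\<close>

text \<open>
  The left-hand side is the contribution of a box point of weight \<open>w\<close> to the count; the right-hand
  side no longer asks for \<open>w \<le> n\<close>. If \<open>w = n + D * y\<close> with \<open>y > 0\<close>, then \<open>w < R * D\<close> forces \<open>y < R\<close>, and
  one of the factors \<open>-y + 1, \<dots>, -y + R - 1\<close> is \<open>0\<close>.
\<close>

lemma choose_eq_pochhammer:
  fixes w n D R :: nat
  assumes "D > 0" "R > 0" "w < R * D"
  shows "(if w \<le> n then \<Sum>y | D * y = n - w. of_nat ((R + y - 1) choose y) else 0) =
    (if [int w = int n] (mod int D)
     then pochhammer ((of_nat n - of_nat w) / of_nat D + 1) (R - 1) / fact (R - 1) else 0 :: 'a::field_char_0)"
proof (cases "[int w = int n] (mod int D)")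
  case False
  have "w \<le> n \<Longrightarrow> {y. D * y = n - w} = {}"
  proof (rule ccontr)
    assume "w \<le> n" "{y. D * y = n - w} \<noteq> {}"
    then obtain y where "D * y = n - w" by blast
    then have "n = w + D * y" using \<open>w \<le> n\<close> by simp
    then show False using False by (simp add: cong_def)
  qed
  then show ?thesis using False by simp
next
  case True
  show ?thesis
  proof (cases "w \<le> n")
    case le: True
    then have "D dvd n - w"
      using True by (metis cong_altdef_nat cong_int_iff cong_sym)
    then obtain y where y: "n = w + D * y" using le by (metis dvd_def le_add_diff_inverse)
    have "{y'. D * y' = n - w} = {y}" using y assms by auto
    moreover have "of_nat ((R + y - 1) choose y) = (pochhammer (of_nat y + 1) (R - 1) / fact (R - 1) :: 'a)"
    proof -
      have "(R + y - 1) choose y = (R - 1 + y) choose (R - 1)"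
        using assms binomial_symmetric[of "R - 1" "R - 1 + y"] by (simp add: Suc_diff_le)
      then show ?thesis by (simp add: binomial_gbinomial gbinomial_pochhammer')
    qed
    moreover have "(of_nat n - of_nat w) / of_nat D = (of_nat y :: 'a)"
      using y assms by simp
    ultimately show ?thesis using True le by simp
  next
    case False
    then have "D dvd w - n"
      using True by (metis cong_altdef_nat cong_int_iff nle_le)
    then obtain y where y: "w = n + D * y" using False by (metis dvd_def le_add_diff_inverse nle_le)
    have "D * y \<le> w" using y by simp
    also have "w < D * R" using assms(3) by (simp only: mult.commute)
    finally have "D * y < D * R" .
    then have "y < R" by simp
    moreover have "y > 0" using y False by (cases y) auto
    ultimately have "pochhammer (- of_nat (y - 1) :: 'a) (R - 1) = 0"
      by (intro pochhammer_of_nat_eq_0_lemma) simp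
    moreover have "(of_nat n - of_nat w) / of_nat D + 1 = (- of_nat (y - 1) :: 'a)"
      using y assms \<open>y > 0\<close> by (simp add: of_nat_diff)
    ultimately show ?thesis using False by simp
  qed
qed

text \<open>
  The coefficient of \<open>X^n\<close> in \<open>(\<Prod>\<^sub>s Q\<^sub>s(X^a\<^sub>s)) / (1 - X^D)^(r * k)\<close>. The weight on the box is less than
  \<open>r * k * D\<close> because \<open>a\<^sub>s l\<^sub>s \<le> k (D - a\<^sub>s) < k D\<close> for each \<open>s\<close>.
\<close>

lemma multipartition_count_eq_sum_box:
  assumes r: "r > 0" and k: "k > 0" and a: "\<And>i. i \<in> {1..r} \<Longrightarrow> a i > 0"
    and D: "D > 0" "\<And>i. i \<in> {1..r} \<Longrightarrow> a i dvd D"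
  shows "of_nat (multipartition_count k r a n) =
    (\<Sum>l \<in> {l \<in> box_C k r a D. [(\<Sum>s = 1..r. int (a s) * l s) = int n] (mod (int D))}.
      (\<Prod>s = 1..r. factor_coeff k (D div a s) (l s)) *
      (pochhammer ((of_nat n - of_int (\<Sum>s = 1..r. int (a s) * l s)) / of_nat D + 1) (r * k - 1)
        / fact (r * k - 1) :: 'a::field_char_0))"
proof -
  let ?q = "\<lambda>s. D div a s" and ?R = "r * k"
  let ?B = "box_C k r a D"
  let ?A = "\<lambda>l. \<Sum>s = 1..r. int (a s) * l s"
  let ?W = "\<lambda>l. \<Sum>s = 1..r. a s * nat (l s)"
  let ?c = "\<lambda>l. \<Prod>s = 1..r. factor_coeff k (?q s) (l s) :: 'a"
  let ?N = "\<Prod>s = 1..r. Abs_fps (\<lambda>n. \<Sum>y | y \<in> {0..int k * (int (?q s) - 1)} \<and> a s * nat y = n. factor_coeff k (?q s) y) :: 'a fps"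
  let ?H = "\<lambda>n. \<Sum>y | D * y = n. of_nat ((?R + y - 1) choose y) :: 'a"
  have R: "?R > 0" using r k by simp
  have q: "?q s > 0" "a s * ?q s = D" if "s \<in> {1..r}" for s
    using a[OF that] D(1) D(2)[OF that] by (auto simp: dvd_div_eq_0_iff intro: Nat.gr0I)
  have finB: "finite ?B" by (simp add: box_C_def finite_PiE)
  have W: "int (?W l) = ?A l" "?W l < ?R * D" if "l \<in> ?B" for l
  proof -
    have l: "0 \<le> l s" "l s \<le> int k * (int (?q s) - 1)" if "s \<in> {1..r}" for s
      using \<open>l \<in> ?B\<close> that by (auto simp: box_C_def PiE_def Pi_def)
    show WA: "int (?W l) = ?A l" using l by simp
    have "int (a s) * l s < int (k * D)" if s: "s \<in> {1..r}" for s
    proof -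
      have "int (a s) * l s \<le> int (a s) * (int k * (int (?q s) - 1))"
        using l(2)[OF s] by (intro mult_left_mono) auto
      also have "\<dots> = int k * (int (a s * ?q s) - int (a s))" by (simp add: algebra_simps)
      also have "\<dots> < int (k * D)" unfolding q(2)[OF s] using a[OF s] k by simp
      finally show ?thesis .
    qed
    then have "?A l < (\<Sum>s = 1..r. int (k * D))" using r by (intro sum_strict_mono) auto
    then show "?W l < ?R * D" unfolding WA[symmetric]
      by (simp add: mult.assoc flip: of_nat_mult del: of_nat_sum)
  qed
  have N: "?N $ i = (\<Sum>l | l \<in> ?B \<and> ?W l = i. ?c l)" for i
    unfolding box_C_def
    by (rule conjunct2[OF fps_prod_weighted_PiE]) (auto intro: finite_subset[OF _ finite_atLeastAtMost_int])
  have H: "inverse ((1 - fps_X ^ D) ^ ?R) = Abs_fps ?H"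
  proof (intro fps_ext)
    fix n
    have "inverse ((1 - fps_X ^ D) ^ ?R :: 'a fps) = inverse ((1 - fps_X) ^ ?R) oo fps_X ^ D"
      using D by (simp add: fps_compose_power[symmetric] fps_compose_sub_distrib fps_inverse_power fps_inverse_compose)
    also have "inverse ((1 - fps_X) ^ ?R :: 'a fps) = Abs_fps (\<lambda>y. of_nat ((?R + y - 1) choose y))"
      using one_minus_const_fps_X_neg_power'[OF R, of "1::'a"] by simp
    finally show "inverse ((1 - fps_X ^ D) ^ ?R :: 'a fps) $ n = Abs_fps ?H $ n"
      using D by (simp add: fps_compose_X_power_nth)
  qed
  have "?N = (\<Prod>s = 1..r. (1 - fps_X ^ D) ^ k * inverse (1 - fps_X ^ a s) ^ k)"
    using factor_coeff_fps[OF a q(1) k, where 'a = 'a] q(2) by (intro prod.cong) auto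
  also have "\<dots> = (1 - fps_X ^ D) ^ ?R * (\<Prod>s = 1..r. inverse (1 - fps_X ^ a s)) ^ k"
    by (simp add: prod.distrib prod_power_distrib mult.commute flip: power_mult)
  finally have num: "?N = (1 - fps_X ^ D) ^ ?R * (\<Prod>s = 1..r. inverse (1 - fps_X ^ a s)) ^ k" .
  have unit: "(1 - fps_X ^ D) ^ ?R * inverse ((1 - fps_X ^ D) ^ ?R) = (1 :: 'a fps)"
    using D(1) by (intro inverse_mult_eq_1') (simp add: fps_nth_power_0 zero_power)
  have "?N * inverse ((1 - fps_X ^ D) ^ ?R) =
      (\<Prod>s = 1..r. inverse (1 - fps_X ^ a s)) ^ k * ((1 - fps_X ^ D) ^ ?R * inverse ((1 - fps_X ^ D) ^ ?R))"
    unfolding num by (simp only: mult.assoc mult.left_commute)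
  also have "\<dots> = Abs_fps (\<lambda>n. of_nat (multipartition_count k r a n))"
    unfolding unit mult_1_right by (rule multipartition_count_fps[OF a, symmetric])
  finally have "of_nat (multipartition_count k r a n) = (?N * Abs_fps ?H) $ n"
    unfolding H by (simp only: fps_nth_Abs_fps)
  also have "\<dots> = (\<Sum>i = 0..n. \<Sum>l | l \<in> ?B \<and> ?W l = i. ?c l * ?H (n - ?W l))"
    unfolding fps_mult_nth N fps_nth_Abs_fps sum_distrib_right by (intro sum.cong refl) auto
  also have "\<dots> = (\<Sum>i = 0..n. \<Sum>l | l \<in> {l \<in> ?B. ?W l \<le> n} \<and> ?W l = i. ?c l * ?H (n - ?W l))"
    by (intro sum.cong) auto
  also have "\<dots> = (\<Sum>l | l \<in> ?B \<and> ?W l \<le> n. ?c l * ?H (n - ?W l))"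
    using finB by (intro sum.group) auto
  also have "\<dots> = (\<Sum>l\<in>?B. if ?W l \<le> n then ?c l * ?H (n - ?W l) else 0)"
    by (rule sum.inter_filter[OF finB])
  also have "\<dots> = (\<Sum>l\<in>?B. if [?A l = int n] (mod int D)
      then ?c l * (pochhammer ((of_nat n - of_int (?A l)) / of_nat D + 1) (?R - 1) / fact (?R - 1)) else 0)"
  proof (rule sum.cong[OF refl])
    fix l assume l: "l \<in> ?B"
    have if_mult: "(if P then c * x else 0) = c * (if P then x else 0)" for P and c x :: 'a
      by simp
    show "(if ?W l \<le> n then ?c l * ?H (n - ?W l) else 0) = (if [?A l = int n] (mod int D)
      then ?c l * (pochhammer ((of_nat n - of_int (?A l)) / of_nat D + 1) (?R - 1) / fact (?R - 1)) else 0)"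
      unfolding if_mult W(1)[OF l, symmetric] of_int_of_nat_eq
      by (intro arg_cong[where f = "(*) (?c l)"] choose_eq_pochhammer D(1) R W(2) l)
  qed
  also have "\<dots> = (\<Sum>l | l \<in> ?B \<and> [?A l = int n] (mod int D).
      ?c l * (pochhammer ((of_nat n - of_int (?A l)) / of_nat D + 1) (?R - 1) / fact (?R - 1)))"
    by (rule sum.inter_filter[OF finB, symmetric])
  finally show ?thesis .
qed

section \<open>Expansion into powers of the argument\<close>

text \<open>
  The rising factorial \<open>x (x + 1) \<cdots> (x + R - 1)\<close> generates the Stirling numbers; here one factor
  \<open>x\<close> is cancelled, so \<open>x = 0\<close> is treated separately.
\<close>

lemma pochhammer_stirling:
  fixes x :: "'a::field_char_0"
  assumes "R > 0"
  shows "pochhammer (x + 1) (R - 1) = (\<Sum>t<R. of_nat (stirling R (t + 1)) * x ^ t)"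
proof -
  obtain N where R: "R = Suc N" using assms by (cases R) auto
  show ?thesis
  proof (cases "x = 0")
    case True
    have "(\<Sum>t<Suc N. of_nat (stirling R (t + 1)) * x ^ t) = of_nat (stirling R 1)"
      using True by (subst sum.lessThan_Suc_shift) simp
    then show ?thesis using True R by (simp add: pochhammer_fact[symmetric] stirling_Suc_n_1 of_nat_fact del: stirling.simps)
  next
    case False
    have "x * pochhammer (x + 1) N = (\<Sum>k\<le>Suc N. of_nat (stirling R k) * x ^ k)"
      using stirling_pochhammer[of R x] by (simp only: R pochhammer_rec)
    also have "\<dots> = x * (\<Sum>t<R. of_nat (stirling R (t + 1)) * x ^ t)"
      using R by (subst sum.atMost_Suc_shift) (simp add: sum_distrib_left lessThan_Suc_atMost ac_simps)
    finally show ?thesis using False R by simp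
  qed
qed

text \<open>
  Each power of \<open>(x - y) / D\<close> is expanded by the binomial theorem, and the triangular double sum
  over \<open>m \<le> t < R\<close> is reordered to collect the powers of \<open>x\<close>.
\<close>

lemma pochhammer_shifted_expansion:
  fixes x y D :: "'a::field_char_0"
  assumes "R > 0"
  shows "pochhammer ((x - y) / D + 1) (R - 1) =
    (\<Sum>m<R. (\<Sum>t = m..R - 1. of_nat (stirling R (t + 1)) * (- 1) ^ (t - m) * of_nat (t choose m) *
         (1 / D ^ t) * y ^ (t - m)) * x ^ m)"
proof -
  let ?s = "\<lambda>t. of_nat (stirling R (t + 1)) :: 'a"
  let ?f = "\<lambda>t m. ?s t * (- 1) ^ (t - m) * of_nat (t choose m) * (1 / D ^ t) * y ^ (t - m) * x ^ m"
  have pw: "((x - y) / D) ^ t = (\<Sum>m\<le>t. of_nat (t choose m) * x ^ m * ((- 1) ^ (t - m) * y ^ (t - m))) / D ^ t" for t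
    using binomial_ring[of x "- y" t] by (simp add: power_divide power_minus[of y])
  have "pochhammer ((x - y) / D + 1) (R - 1) = (\<Sum>t<R. ?s t * ((x - y) / D) ^ t)"
    by (rule pochhammer_stirling[OF assms])
  also have "\<dots> = (\<Sum>t<R. \<Sum>m\<le>t. ?f t m)"
    unfolding pw by (simp add: sum_divide_distrib sum_distrib_left ac_simps)
  also have "\<dots> = (\<Sum>t<R. \<Sum>m | m \<in> {..<R} \<and> m \<le> t. ?f t m)"
    by (intro sum.cong) auto
  also have "\<dots> = (\<Sum>m<R. \<Sum>t | t \<in> {..<R} \<and> m \<le> t. ?f t m)"
    by (rule sum.swap_restrict) auto
  also have "\<dots> = (\<Sum>m<R. \<Sum>t = m..R - 1. ?f t m)"
    using assms by (intro sum.cong) auto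
  finally show ?thesis by (simp only: sum_distrib_right)
qed

section \<open>Quasi-polynomial coefficients\<close>

text \<open>
  Along a residue class modulo \<open>D\<close> the coefficients are constant, so two representations differ there
  by a single polynomial with infinitely many zeros.
\<close>

lemma quasi_poly_coeffs_unique:
  assumes "D > 0" and d: "quasi_poly_coeffs p D N d" and e: "quasi_poly_coeffs p D N e"
  shows "d = e"
proof (intro ext)
  fix m n
  have per: "f m (n + j * D) = f m n" if "quasi_poly_coeffs p D N f" "m < N" for f m j
  proof (induction j)
    case (Suc j)
    then show ?case using that by (simp add: quasi_poly_coeffs_def) (metis add.assoc add.commute)
  qed simp
  let ?P = "\<Sum>m<N. monom (d m n - e m n) m"
  have "poly ?P (of_nat (n + j * D)) = 0" for j
  proof -
    have "poly ?P (of_nat (n + j * D)) =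
      (\<Sum>m<N. d m (n + j * D) * of_nat (n + j * D) ^ m) - (\<Sum>m<N. e m (n + j * D) * of_nat (n + j * D) ^ m)"
      using per[OF d] per[OF e]
      by (simp add: poly_sum poly_monom left_diff_distrib flip: sum_subtractf del: of_nat_add of_nat_mult)
    also have "(\<Sum>m<N. d m (n + j * D) * of_nat (n + j * D) ^ m) = of_nat (p (n + j * D))"
      using d by (simp only: quasi_poly_coeffs_def)
    also have "(\<Sum>m<N. e m (n + j * D) * of_nat (n + j * D) ^ m) = of_nat (p (n + j * D))"
      using e by (simp only: quasi_poly_coeffs_def)
    finally show ?thesis by simp
  qed
  then have "range (\<lambda>j. of_nat (n + j * D)) \<subseteq> {x. poly ?P x = 0}" by auto
  moreover have "infinite (range (\<lambda>j. of_nat (n + j * D) :: rat))"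
    using assms(1) by (intro range_inj_infinite injI) (simp del: of_nat_add of_nat_mult)
  ultimately have "?P = 0" using poly_roots_finite finite_subset by blast
  then have "coeff ?P m = 0" by simp
  then have "m < N \<Longrightarrow> d m n = e m n" by (simp add: coeff_sum)
  then show "d m n = e m n" using d e by (cases "m < N") (auto simp: quasi_poly_coeffs_def)
qed


theorem theorem3p1:
  fixes r k D m n :: nat and a :: "nat \<Rightarrow> nat"
  assumes "r \<ge> 1" and "k \<ge> 2"
    and "\<And>i. i \<in> {1..r} \<Longrightarrow> a i > 0"
    and "D = Lcm (a ` {1..r})"
    and "m \<le> r * k - 1"
  shows "multipartition_coeff k r a m n =
    1 / fact (r * k - 1) *
    (\<Sum>l \<in> {l \<in> box_C k r a D. [(\<Sum>s = 1..r. int (a s) * l s) = int n] (mod (int D))}.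
      (\<Prod>s = 1..r. \<Sum>(i, j) \<in> {(i, j). int i * int (D div a s) + int j = l s}.
         (- 1) ^ i * of_nat (k choose i) * of_nat ((j + k - 1) choose j)) *
      (\<Sum>t = m..r * k - 1.
         of_nat (stirling (r * k) (t + 1)) * (- 1) ^ (t - m) * of_nat (t choose m) *
         (1 / of_nat D ^ t) * of_int (\<Sum>s = 1..r. int (a s) * l s) ^ (t - m)))"
proof -
  let ?R = "r * k"
  let ?A = "\<lambda>l. \<Sum>s = 1..r. int (a s) * l s"
  let ?L = "\<lambda>n. {l \<in> box_C k r a D. [?A l = int n] (mod (int D))}"
  let ?c = "\<lambda>l. \<Prod>s = 1..r. factor_coeff k (D div a s) (l s) :: rat"
  let ?T = "\<lambda>m l. \<Sum>t = m..?R - 1.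
         of_nat (stirling ?R (t + 1)) * (- 1) ^ (t - m) * of_nat (t choose m) *
         (1 / of_nat D ^ t) * of_int (?A l) ^ (t - m) :: rat"
  define e where "e = (\<lambda>m n. if m < ?R then 1 / fact (?R - 1) * (\<Sum>l\<in>?L n. ?c l * ?T m l) else 0)"
  have R: "?R > 0" using assms by simp
  have D: "D > 0" "\<And>i. i \<in> {1..r} \<Longrightarrow> a i dvd D"
    using assms(3) unfolding assms(4) by (force intro!: Nat.gr0I simp: Lcm_0_iff)+
  have count: "of_nat (multipartition_count k r a n) = (\<Sum>m<?R. e m n * of_nat n ^ m)" for n
  proof -
    have "of_nat (multipartition_count k r a n) =
      (\<Sum>l\<in>?L n. ?c l * ((\<Sum>m<?R. ?T m l * of_nat n ^ m) / fact (?R - 1)))"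
      using multipartition_count_eq_sum_box[of r k a D n, where 'a = rat] assms D
        pochhammer_shifted_expansion[OF R, of "of_nat n :: rat" _ "of_nat D"] by simp
    also have "\<dots> = (\<Sum>l\<in>?L n. \<Sum>m<?R. ?c l * ?T m l / fact (?R - 1) * of_nat n ^ m)"
    proof (rule sum.cong[OF refl])
      have eq: "c * (sum T {..<?R} / f) = (\<Sum>m<?R. c * T m / f)" for c f :: rat and T
        by (simp add: sum_distrib_left sum_divide_distrib)
      show "?c l * ((\<Sum>m<?R. ?T m l * of_nat n ^ m) / fact (?R - 1)) =
        (\<Sum>m<?R. ?c l * ?T m l / fact (?R - 1) * of_nat n ^ m)" for l
        unfolding eq by (simp only: times_divide_eq_left mult.assoc)
    qed
    also have "\<dots> = (\<Sum>m<?R. \<Sum>l\<in>?L n. ?c l * ?T m l / fact (?R - 1) * of_nat n ^ m)"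
      by (rule sum.swap)
    also have "\<dots> = (\<Sum>m<?R. e m n * of_nat n ^ m)"
      unfolding e_def by (intro sum.cong) (simp_all add: sum_distrib_right sum_divide_distrib del: of_int_sum)
    finally show ?thesis .
  qed
  have "?L (n + D) = ?L n" for n by (simp add: cong_def)
  then have quasi: "quasi_poly_coeffs (multipartition_count k r a) D ?R e"
    using count unfolding quasi_poly_coeffs_def by (simp add: e_def)
  have "multipartition_coeff k r a = e"
    unfolding multipartition_coeff_def assms(4)[symmetric]
    using quasi quasi_poly_coeffs_unique[OF D(1)] by (intro the_equality) blast+
  moreover have "m < ?R" using assms(5) R by linarith
  ultimately show ?thesis by (simp only: e_def factor_coeff_def if_True)
qed

end
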